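(* Let $x>0$, let $m,p\in\mathbb{N}$, and let $g\in\mathcal{D}^p\cap\mathcal{K}^{p+m}$. Then $$\Sigma^{m+1}g(x)=\lim_{n\to\infty}f_n^{p+m}[\Sigma^m g](x).$$
   Context: $\mathbb{N}$ is the set of nonnegative integers, $\mathbb{R}_+=(0,\infty)$, $\Delta f(x)=f(x+1)-f(x)$, and $\binom{x}{j}=x(x-1)\cdots(x-j+1)/j!$ for real $x$ and $j\in\mathbb{N}$. For an integer $p\ge -1$, a function $f$ on a real interval $I$ is $p$-convex if its divided difference $f[x_0,\dots,x_{p+1}]$ is $\ge 0$ at any $p+2$ pairwise distinct points of $I$, and $p$-concave if $-f$ is $p$-convex. For $p\in\mathbb{N}$, $\mathcal{D}^p$ is the set of functions $f\colon\mathbb{R}_+\to\mathbb{R}$ such that $\Delta^pf(n)\to0$ as the integer $n\to\infty$. For an integer $p\ge-1$, $\mathcal{K}^p$ is the set of functions $f\colon\mathbb{R}_+\to\mathbb{R}$ that are eventually $p$-convex or eventually $p$-concave (i.e. $p$-convex, or $p$-concave, on some half-line $(M,\infty)$). Definition of $\Sigma$ (known well-definedness): $\mathrm{dom}\,\Sigma=\bigcup_{p\ge0}(\mathcal{D}^p\cap\mathcal{K}^p)$. If $g\in\mathcal{D}^p\cap\mathcal{K}^p$, then $\Sigma g\colon\mathbb{R}_+\to\mathbb{R}$ is the unique solution $f\in\mathcal{K}^p$ of $\Delta f=g$ on $\mathbb{R}_+$ with $f(1)=0$; it is given by $\Sigma g(x)=\lim_{n\to\infty}f_n^p[g](x)$,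 where for any $q\in\mathbb{N}$, $n\ge1$ and $h\colon\mathbb{R}_+\to\mathbb{R}$ $$f_n^q[h](x)=\sum_{k=1}^{n-1}h(k)-\sum_{k=0}^{n-1}h(x+k)+\sum_{j=1}^q\binom{x}{j}\Delta^{j-1}h(n),$$ and it does not depend on the choice of $p$. Iterates: $\Sigma^0=\mathrm{id}$, $\Sigma^{m+1}=\Sigma\circ\Sigma^m$; $g\in\mathrm{dom}\,\Sigma^{m+1}$ means $g\in\mathrm{dom}\,\Sigma^m$ and $\Sigma^mg\in\mathrm{dom}\,\Sigma$. It is known that $\mathcal{D}^p\cap\mathcal{K}^{p+m}\subset\mathrm{dom}\,\Sigma^{m+1}$, so the functions in the claim are defined. *)

theory Defs
  imports Complex_Main "HOL-Library.FuncSet"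
begin

text \<open>
  A function on \<open>(0,\<infinity>)\<close> is represented by a function of type \<^typ>\<open>real \<Rightarrow> real\<close>. The classes
  and the operator below depend only on its values at positive arguments.
\<close>

definition fwd_diff :: "(real \<Rightarrow> real) \<Rightarrow> real \<Rightarrow> real" where
  "fwd_diff f x = f (x + 1) - f x"

text \<open>The divided difference \<open>f[x\<^sub>0, \<dots>, x\<^sub>n]\<close>, for pairwise distinct points given as a list.\<close>

fun divided_diff :: "(real \<Rightarrow> real) \<Rightarrow> real list \<Rightarrow> real" where
  "divided_diff f [] = 0"
| "divided_diff f [x] = f x"
| "divided_diff f (x # y # ys) =
     (divided_diff f (y # ys) - divided_diff f (x # butlast (y # ys))) / (last (y # ys) - x)"

text \<open>The order \<open>p\<close> is an integer, and \<open>p \<ge> -1\<close> is the intended range.\<close>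

definition p_convex_on :: "int \<Rightarrow> real set \<Rightarrow> (real \<Rightarrow> real) \<Rightarrow> bool" where
  "p_convex_on p I f \<longleftrightarrow>
     (\<forall>xs. length xs = nat (p + 2) \<and> distinct xs \<and> set xs \<subseteq> I \<longrightarrow> divided_diff f xs \<ge> 0)"

definition p_concave_on :: "int \<Rightarrow> real set \<Rightarrow> (real \<Rightarrow> real) \<Rightarrow> bool" where
  "p_concave_on p I f \<longleftrightarrow> p_convex_on p I (\<lambda>x. - f x)"

definition D_class :: "nat \<Rightarrow> (real \<Rightarrow> real) set" where
  "D_class p = {f. (\<lambda>n::nat. (fwd_diff ^^ p) f (real n)) \<longlonglongrightarrow> 0}"

definition K_class :: "int \<Rightarrow> (real \<Rightarrow> real) set" where
  "K_class p = {f. \<exists>M\<ge>0. p_convex_on p {M<..} f \<or> p_concave_on p {M<..} f}"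

text \<open>
  The operator \<open>\<Sigma>\<close>. The value at \<open>g\<close> is meaningful only on the domain of \<open>\<Sigma>\<close>, that is, if
  \<open>g \<in> D_class p \<inter> K_class (int p)\<close> for some \<open>p\<close>. The solution is then unique on \<open>(0,\<infinity>)\<close> and
  does not depend on \<open>p\<close>; membership in \<^const>\<open>extensional\<close> normalises the irrelevant values
  outside \<open>(0,\<infinity>)\<close>, so that there is exactly one such function on the whole type.
\<close>

definition principal_sum :: "(real \<Rightarrow> real) \<Rightarrow> real \<Rightarrow> real" where
  "principal_sum g =
     (THE f. f \<in> extensional {0<..} \<and>
        (\<exists>p::nat. g \<in> D_class p \<inter> K_class (int p) \<and> f \<in> K_class (int p)) \<and>
        (\<forall>x>0. fwd_diff f x = g x) \<and> f 1 = 0)"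

text \<open>The function \<open>f\<^sub>n\<^sup>q[h]\<close>, meant for \<open>n \<ge> 1\<close> and positive arguments.\<close>

definition f_seq :: "nat \<Rightarrow> (real \<Rightarrow> real) \<Rightarrow> nat \<Rightarrow> real \<Rightarrow> real" where
  "f_seq q h n x =
     (\<Sum>k=1..<n. h (real k)) - (\<Sum>k=0..<n. h (x + real k))
       + (\<Sum>j=1..q. (x gchoose j) * (fwd_diff ^^ (j - 1)) h (real n))"

end

theory Submission
  imports Defs
begin

text \<open>
  Everything rests on Newton interpolation of \<open>f\<close> at the nodes \<open>a, a + 1, \<dots>, a + k - 1\<close>, whose
  remainder at \<open>a + x\<close> is
  \<open>\<rho>\<^sub>k(a, x) = f(a + x) - (\<Sum>j<k. (x gchoose j) \<Delta>\<^sup>j f(a)) = f[a, \<dots>, a + k - 1, a + x] (\<Prod>i<k. x - i)\<close>.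

  If \<open>f\<close> is eventually \<open>q\<close>-convex, the divided differences of \<open>f\<close> at \<open>q + 1\<close> points increase when
  the points move to the right. Comparing the nodes \<open>n + 1, \<dots>, n + q, n + x\<close> with a block of
  consecutive nodes further to the right bounds the remainder:
  \<open>\<bar>\<rho>\<^bsub>q+1\<^esub>(n, x)\<bar> \<le> C (\<Delta>\<^sup>q f(n + N) - \<Delta>\<^sup>q f(n))\<close> for large \<open>n\<close>, with \<open>C\<close> and \<open>N\<close> independent of \<open>n\<close>
  (lemma \<open>newton_rem_bound\<close>). This bound is used twice.

  \<^item> Suppose that \<open>f\<close> in \<open>K\<^sup>q\<close> solves \<open>\<Delta>f = g\<close> with \<open>f(1) = 0\<close> and \<open>g\<close> in \<open>D\<^sup>q\<close>. Then
    \<open>f\<^sub>n\<^sup>q[g](x) = f(x) - \<rho>\<^bsub>q+1\<^esub>(n, x)\<close> with the remainder of \<open>f\<close>, and the bound, \<open>C\<close> times a sum of \<open>N\<close>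
    values of \<open>\<Delta>\<^sup>q g\<close>, tends to \<open>0\<close>. So \<open>f\<close> is the limit of \<open>f\<^sub>n\<^sup>q[g]\<close> (lemma \<open>f_seq_tendsto_solution\<close>), and hence
    unique; raising \<open>q\<close> adds only vanishing terms to \<open>f\<^sub>n\<^sup>q[g]\<close>, so \<open>f\<close> does not depend on \<open>q\<close> either.

  \<^item> Suppose that \<open>g\<close> lies in \<open>D\<^sup>q\<close> and \<open>K\<^sup>q\<close>. The increments of \<open>f\<^sub>n\<^sup>q[g](x)\<close> in \<open>n\<close> are the negated
    remainders of \<open>g\<close>, and now the bound is summable in \<open>n\<close>, by telescoping. So the limit exists.
    It solves the difference equation, and it is in \<open>K\<^sup>q\<close> because, up to a polynomial of degree at
    most \<open>q\<close> in \<open>x\<close>, \<open>f\<^sub>n\<^sup>q[g]\<close> is minus a sum of translates of \<open>g\<close>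
    (lemma \<open>principal_solution_exists\<close>).

  Hence \<open>\<Sigma>\<close> maps \<open>D\<^sup>q \<inter> K\<^sup>q\<close> to \<open>K\<^sup>q\<close>. It also raises the index of \<open>D\<close> by one, so for
  \<open>g\<close> in \<open>D\<^sup>p \<inter> K\<^bsup>p+m\<^esup>\<close> all of \<open>g, \<Sigma>g, \<dots>, \<Sigma>\<^sup>m g\<close> stay in \<open>D\<^bsup>p+m\<^esup> \<inter> K\<^bsup>p+m\<^esup>\<close>, on which \<open>\<Sigma>\<close> is the limit
  of the operators \<open>f\<^sub>n\<^bsup>p+m\<^esup>\<close>.
\<close>


section \<open>Divided differences\<close>

lemma divided_diff_Cons_snoc:
  "divided_diff f (x # zs @ [y]) =
     (divided_diff f (zs @ [y]) - divided_diff f (x # zs)) / (y - x)"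
  by (cases zs) (auto simp: butlast_append)

text \<open>
  The recursion for divided differences drops either of the two end points, hence the shape of this
  rule.
\<close>

lemma list_ends_induct [case_names Nil single ends]:
  assumes "P []" "\<And>x. P [x]"
    and "\<And>x zs y. P (zs @ [y]) \<Longrightarrow> P (x # zs) \<Longrightarrow> P (x # zs @ [y])"
  shows "P xs"
proof (induction "length xs" arbitrary: xs rule: less_induct)
  case less
  show ?case
  proof (cases xs)
    case Nil
    then show ?thesis using assms(1) by simp
  next
    case (Cons x ys)
    show ?thesis
    proof (cases ys rule: rev_cases)
      case Nil
      then show ?thesis using Cons assms(2) by simp
    next
      case (snoc zs y)
      have "P (zs @ [y])" "P (x # zs)"
        using Cons snoc by (auto intro!: less)
      then show ?thesis using Cons snoc assms(3) by simp
    qed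
  qed
qed

lemma divided_diff_add:
  "divided_diff (\<lambda>x. f x + g x) xs = divided_diff f xs + divided_diff g xs"
  by (induction xs rule: list_ends_induct)
    (simp_all add: divided_diff_Cons_snoc add_divide_distrib[symmetric]
      del: divided_diff.simps(3))

lemma divided_diff_cmult:
  "divided_diff (\<lambda>x. c * f x) xs = c * divided_diff f xs"
  by (induction xs rule: list_ends_induct)
    (simp_all add: divided_diff_Cons_snoc right_diff_distrib[symmetric])

lemma divided_diff_minus:
  "divided_diff (\<lambda>x. - f x) xs = - divided_diff f xs"
  using divided_diff_cmult[of "-1" f xs] by simp

lemma divided_diff_sum:
  "divided_diff (\<lambda>x. \<Sum>i\<in>A. f i x) xs = (\<Sum>i\<in>A. divided_diff (f i) xs)"
proof (induction A rule: infinite_finite_induct)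
  case (insert a A)
  then show ?case by (simp add: divided_diff_add)
qed (use divided_diff_cmult[of 0 "\<lambda>_. 0" xs] in simp_all)

lemma divided_diff_shift:
  "divided_diff (\<lambda>x. f (x + c)) xs = divided_diff f (map (\<lambda>x. x + c) xs)"
  by (induction xs rule: list_ends_induct) (simp_all add: divided_diff_Cons_snoc)

lemma tendsto_divided_diff:
  assumes "\<And>x. x \<in> set xs \<Longrightarrow> ((\<lambda>n. F n x) \<longlongrightarrow> f x) net"
  shows "((\<lambda>n. divided_diff (F n) xs) \<longlongrightarrow> divided_diff f xs) net"
  using assms
proof (induction xs rule: list_ends_induct)
  case (ends x zs y)
  then have "((\<lambda>n. divided_diff (F n) (zs @ [y])) \<longlongrightarrow> divided_diff f (zs @ [y])) net"
    "((\<lambda>n. divided_diff (F n) (x # zs)) \<longlongrightarrow> divided_diff f (x # zs)) net"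
    by (auto intro!: ends.IH)
  from tendsto_diff[OF this] show ?case
    unfolding divided_diff_Cons_snoc divide_inverse by (rule tendsto_mult_right)
qed simp_all

lemma divided_diff_const:
  assumes "length xs \<ge> 2"
  shows "divided_diff (\<lambda>_. c) xs = 0"
  using assms
proof (induction xs rule: list_ends_induct)
  case (ends x zs y)
  have "divided_diff (\<lambda>_. c) (zs @ [y]) = divided_diff (\<lambda>_. c) (x # zs)"
  proof (cases "zs = []")
    case False
    then have "2 \<le> length (zs @ [y])" "2 \<le> length (x # zs)"
      by (simp_all add: Suc_le_eq)
    from ends.IH(1)[OF this(1)] ends.IH(2)[OF this(2)] show ?thesis by (rule trans[OF _ sym])
  qed simp
  then show ?case unfolding divided_diff_Cons_snoc by simp
qed simp_all

text \<open>The Leibniz rule for a product whose first factor is the identity.\<close>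

lemma divided_diff_times_id:
  assumes "distinct (x # xs)" "xs \<noteq> []"
  shows "divided_diff (\<lambda>t. t * v t) (x # xs) = x * divided_diff v (x # xs) + divided_diff v xs"
  using assms
proof (induction "length xs" arbitrary: x xs rule: less_induct)
  case less
  from less.prems obtain zs y where xs: "xs = zs @ [y]"
    by (cases xs rule: rev_cases) auto
  show ?case
  proof (cases zs)
    case Nil
    with xs less.prems show ?thesis by (simp add: field_simps)
  next
    case (Cons z ws)
    have ne: "y - x \<noteq> 0" "y - z \<noteq> 0" using less.prems xs Cons by auto
    let ?d = "divided_diff v"
    have 1: "divided_diff (\<lambda>t. t * v t) (z # ws @ [y]) = z * ?d (z # ws @ [y]) + ?d (ws @ [y])"
      by (rule less.hyps) (use less.prems xs Cons in auto)
    have 2: "divided_diff (\<lambda>t. t * v t) (x # z # ws) = x * ?d (x # z # ws) + ?d (z # ws)"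
      by (rule less.hyps) (use less.prems xs Cons in auto)
    have 3: "?d (ws @ [y]) - ?d (z # ws) = (y - z) * ?d (z # ws @ [y])"
      using ne by (simp add: divided_diff_Cons_snoc)
    have 4: "?d (z # ws @ [y]) - ?d (x # z # ws) = (y - x) * ?d (x # (z # ws) @ [y])"
      using ne by (subst divided_diff_Cons_snoc) simp
    have "divided_diff (\<lambda>t. t * v t) (z # ws @ [y]) - divided_diff (\<lambda>t. t * v t) (x # z # ws)
        = (y - x) * (x * ?d (x # (z # ws) @ [y]) + ?d (z # ws @ [y]))"
      using 1 2 3 4 by algebra
    then have "divided_diff (\<lambda>t. t * v t) (x # (z # ws) @ [y])
        = x * ?d (x # (z # ws) @ [y]) + ?d (z # ws @ [y])"
      using ne by (subst divided_diff_Cons_snoc) simp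
    then show ?thesis using xs Cons by simp
  qed
qed

text \<open>Divided differences of a polynomial at too many points vanish; the binomials suffice here.\<close>

lemma divided_diff_gchoose:
  assumes "distinct xs" "length xs \<ge> j + 2"
  shows "divided_diff (\<lambda>t. t gchoose j) xs = 0"
  using assms
proof (induction j arbitrary: xs)
  case 0
  then show ?case by (simp add: divided_diff_const)
next
  case (Suc j)
  then obtain x ys where xs: "xs = x # ys" by (cases xs) auto
  let ?b = "\<lambda>t::real. t gchoose j"
  have eq: "(\<lambda>t::real. t gchoose Suc j) =
      (\<lambda>t. (1 / real (Suc j)) * (t * ?b t + (- real j) * ?b t))"
  proof
    fix t :: real
    have "t * ?b t = real j * ?b t + real (Suc j) * (t gchoose Suc j)"
      by (rule gbinomial_mult_1)
    then have "t * ?b t + (- real j) * ?b t = real (Suc j) * (t gchoose Suc j)" by linarith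
    then show "t gchoose Suc j = (1 / real (Suc j)) * (t * ?b t + (- real j) * ?b t)"
      by (simp del: of_nat_Suc gbinomial_Suc)
  qed
  have "divided_diff (\<lambda>t. t * ?b t) (x # ys) = x * divided_diff ?b (x # ys) + divided_diff ?b ys"
    using Suc.prems xs by (intro divided_diff_times_id) auto
  also have "\<dots> = 0" using Suc.prems xs Suc.IH[of "x # ys"] Suc.IH[of ys] by simp
  finally have "divided_diff (\<lambda>t. t * ?b t) xs = 0" using xs by simp
  moreover have "divided_diff ?b xs = 0" using Suc.prems by (intro Suc.IH) auto
  ultimately show ?case
    unfolding eq divided_diff_cmult divided_diff_add by simp
qed

text \<open>
  Exchanging the nodes one by one, from the left, for the larger ones changes the divided difference
  by a positive multiple of a divided difference at \<open>q + 2\<close> points in each step.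
\<close>

lemma divided_diff_mono_nodes:
  assumes conv: "p_convex_on (int q) I f"
    and len: "length us = q + 1" and less: "list_all2 (<) us vs"
    and dist: "distinct (us @ vs)" and sub: "set us \<union> set vs \<subseteq> I"
  shows "divided_diff f us \<le> divided_diff f vs"
proof -
  have len': "length vs = q + 1" using len less by (auto dest: list_all2_lengthD)
  have "divided_diff f us \<le> divided_diff f (drop k us @ take k vs)" if "k \<le> q + 1" for k
    using that
  proof (induction k)
    case 0
    then show ?case by simp
  next
    case (Suc k)
    define zs where "zs = drop (Suc k) us @ take k vs"
    have du: "drop k us = us ! k # drop (Suc k) us"
      using Suc.prems len by (simp add: Cons_nth_drop_Suc)
    have tv: "take (Suc k) vs = take k vs @ [vs ! k]"
      using Suc.prems len' by (simp add: take_Suc_conv_app_nth)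
    have eq: "us ! k # zs @ [vs ! k] = drop k us @ take (Suc k) vs"
      by (simp add: zs_def du tv)
    have d: "distinct (drop k us @ take (Suc k) vs)"
      using dist by (auto dest: in_set_dropD in_set_takeD)
    have s: "set (drop k us @ take (Suc k) vs) \<subseteq> I"
      using sub by (auto dest: in_set_dropD in_set_takeD)
    have l: "length (drop k us @ take (Suc k) vs) = nat (int q + 2)"
      using Suc.prems len len' by simp
    have "0 \<le> divided_diff f (us ! k # zs @ [vs ! k])"
      using conv d s l unfolding p_convex_on_def eq by blast
    moreover have "us ! k < vs ! k"
      using less Suc.prems len by (simp add: list_all2_conv_all_nth)
    ultimately have "divided_diff f (us ! k # zs) \<le> divided_diff f (zs @ [vs ! k])"
      by (simp add: divided_diff_Cons_snoc zero_le_divide_iff)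
    then show ?case using Suc.IH Suc.prems by (simp add: zs_def du tv)
  qed
  from this[of "q + 1"] show ?thesis using len len' by simp
qed


section \<open>Iterated differences and the Newton remainder\<close>

lemma fwd_diff_pow_plus1:
  "(fwd_diff ^^ k) f (x + 1) = (fwd_diff ^^ k) f x + (fwd_diff ^^ Suc k) f x"
  by (simp add: fwd_diff_def)

lemma fwd_diff_pow_cong:
  assumes "\<And>x. x > 0 \<Longrightarrow> f x = g x" "x > 0"
  shows "(fwd_diff ^^ k) f x = (fwd_diff ^^ k) g x"
  using assms(2)
  by (induction k arbitrary: x) (auto simp: assms(1) fwd_diff_def)

lemma fwd_diff_pow_Suc_eq:
  assumes "\<And>x. x > 0 \<Longrightarrow> fwd_diff f x = g x" "x > 0"
  shows "(fwd_diff ^^ Suc k) f x = (fwd_diff ^^ k) g x"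
  unfolding funpow_Suc_right o_def by (rule fwd_diff_pow_cong) (use assms in auto)

lemma fwd_diff_pow_minus:
  "(fwd_diff ^^ k) (\<lambda>x. - f x) x = - (fwd_diff ^^ k) f x"
  by (induction k arbitrary: x) (auto simp: fwd_diff_def)

definition unit_nodes :: "real \<Rightarrow> nat \<Rightarrow> real list" where
  "unit_nodes a k = map (\<lambda>i. a + real i) [0..<k]"

lemma unit_nodes_0 [simp]: "unit_nodes a 0 = []"
  by (simp add: unit_nodes_def)

lemma unit_nodes_snoc: "unit_nodes a (Suc k) = unit_nodes a k @ [a + real k]"
  by (simp add: unit_nodes_def)

lemma unit_nodes_Cons: "unit_nodes a (Suc k) = a # unit_nodes (a + 1) k"
  unfolding unit_nodes_def upt_conv_Cons[OF zero_less_Suc] map_Suc_upt[symmetric]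
  by (simp del: map_Suc_upt add: add.assoc add.commute)

lemma length_unit_nodes [simp]: "length (unit_nodes a k) = k"
  by (simp add: unit_nodes_def)

lemma set_unit_nodes: "set (unit_nodes a k) = (\<lambda>i. a + real i) ` {..<k}"
  by (auto simp: unit_nodes_def)

lemma distinct_unit_nodes: "distinct (unit_nodes a k)"
  by (auto simp: unit_nodes_def distinct_map inj_on_def)

lemma divided_diff_unit_nodes:
  "divided_diff f (unit_nodes a (Suc k)) = (fwd_diff ^^ k) f a / fact k"
proof (induction k arbitrary: a)
  case 0
  then show ?case by (simp add: unit_nodes_snoc)
next
  case (Suc k)
  have "unit_nodes a (Suc (Suc k)) = a # unit_nodes (a + 1) k @ [a + 1 + real k]"
    by (metis unit_nodes_Cons unit_nodes_snoc)
  then have "divided_diff f (unit_nodes a (Suc (Suc k))) =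
      (divided_diff f (unit_nodes (a + 1) (Suc k)) - divided_diff f (unit_nodes a (Suc k)))
        / real (Suc k)"
    by (simp add: divided_diff_Cons_snoc unit_nodes_snoc[of "a + 1"] unit_nodes_Cons[of a])
  also have "\<dots> = (fwd_diff ^^ Suc k) f a / fact (Suc k)"
    unfolding Suc.IH fwd_diff_pow_plus1 by (simp add: field_simps)
  finally show ?case .
qed

definition newton_rem :: "nat \<Rightarrow> (real \<Rightarrow> real) \<Rightarrow> real \<Rightarrow> real \<Rightarrow> real" where
  "newton_rem k f a x = f (a + x) - (\<Sum>j<k. (x gchoose j) * (fwd_diff ^^ j) f a)"

lemma newton_rem_minus: "newton_rem k (\<lambda>x. - f x) a x = - newton_rem k f a x"
  by (simp add: newton_rem_def fwd_diff_pow_minus sum_negf)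

text \<open>
  Dropping the node \<open>a\<close> turns the remainder at \<open>a\<close> and \<open>x\<close> into the one at \<open>a + 1\<close> and \<open>x - 1\<close>, by
  Pascal's rule. Like the recursion for divided differences, this removes the first node.
\<close>

lemma newton_rem_Suc:
  "newton_rem (Suc k) f a x =
     newton_rem k f (a + 1) (x - 1) - (x - 1 gchoose k) * (fwd_diff ^^ k) f a"
proof -
  let ?D = "\<lambda>j. (fwd_diff ^^ j) f a"
  have "(\<Sum>j<Suc k. (x gchoose j) * ?D j) =
      (\<Sum>j<k. (x - 1 gchoose j) * (?D j + ?D (Suc j))) + (x - 1 gchoose k) * ?D k" for k
  proof (induction k)
    case 0
    then show ?case by simp
  next
    case (Suc k)
    have "x gchoose Suc k = (x - 1 gchoose k) + (x - 1 gchoose Suc k)"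
      using gbinomial_Suc_Suc[of "x - 1" k] by simp
    with Suc.IH show ?case by (simp add: algebra_simps del: funpow.simps)
  qed
  then show ?thesis
    unfolding newton_rem_def fwd_diff_pow_plus1 by (simp add: algebra_simps del: funpow.simps)
qed

text \<open>
  For nonzero \<open>x\<close> both sides obey the same recursion. The equation holds even if \<open>a + x\<close> is one of the nodes: then one factor of the product is \<open>0\<close>, and so is the
  remainder, whatever value division by \<open>0\<close> gives to the divided difference.
\<close>

lemma newton_rem_eq_divided_diff:
  "newton_rem k f a x = divided_diff f (unit_nodes a k @ [a + x]) * (\<Prod>i<k. x - real i)"
proof (induction k arbitrary: a x)
  case 0
  then show ?case by (simp add: newton_rem_def)
next
  case (Suc k)
  let ?P = "\<Prod>i<k. x - 1 - real i"
  have prod: "(\<Prod>i<Suc k. x - real i) = x * ?P"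
    by (subst prod.lessThan_Suc_shift) (simp add: algebra_simps)
  show ?case
  proof (cases "x = 0")
    case True
    have "(\<Sum>j<Suc k. (0 gchoose j) * (fwd_diff ^^ j) f a) = f a"
      by (subst sum.lessThan_Suc_shift) simp
    with True show ?thesis by (simp add: newton_rem_def prod del: sum.lessThan_Suc prod.lessThan_Suc)
  next
    case False
    have "divided_diff f (unit_nodes a (Suc k) @ [a + x]) * x =
        divided_diff f (unit_nodes (a + 1) k @ [a + x]) - (fwd_diff ^^ k) f a / fact k"
      using False unfolding divided_diff_unit_nodes[symmetric] unit_nodes_Cons
      by (simp add: divided_diff_Cons_snoc)
    from arg_cong[OF this, of "\<lambda>t. t * ?P"]
    have "divided_diff f (unit_nodes a (Suc k) @ [a + x]) * (x * ?P) =
        divided_diff f (unit_nodes (a + 1) k @ [a + 1 + (x - 1)]) * ?P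
          - (?P / fact k) * (fwd_diff ^^ k) f a"
      by (simp add: left_diff_distrib mult.assoc)
    also have "?P / fact k = (x - 1 gchoose k)"
      by (simp add: gbinomial_prod_rev atLeast0LessThan)
    finally show ?thesis unfolding prod newton_rem_Suc Suc.IH by simp
  qed
qed

text \<open>
  Put \<open>us = [a + 1, \<dots>, a + q, a + x]\<close>. The divided difference in the remainder, times \<open>x\<close>, is
  \<open>f[us] - f[a, \<dots>, a + q]\<close>. It is nonnegative by convexity, and replacing \<open>us\<close> by a block of
  consecutive nodes to the right of \<open>us\<close> can only enlarge it. The case that \<open>x\<close> is one of
  \<open>1, \<dots>, q\<close> is separate because then the nodes are not distinct, but the remainder is \<open>0\<close>.
\<close>

lemma newton_rem_bound_convex:
  assumes conv: "p_convex_on (int q) {M<..} f" and "a > M" "x > 0" "x \<le> real N" "q \<le> N"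
  shows "\<bar>newton_rem (Suc q) f a x\<bar> \<le>
    (\<Prod>i=1..q. \<bar>x - real i\<bar>) / fact q * ((fwd_diff ^^ q) f (a + real N + 1) - (fwd_diff ^^ q) f a)"
proof -
  let ?d = "divided_diff f" and ?P = "\<Prod>i=1..q. \<bar>x - real i\<bar>"
  have "{..<Suc q} = insert 0 {1..q}" by auto
  then have "\<bar>\<Prod>i<Suc q. x - real i\<bar> = x * ?P"
    using \<open>x > 0\<close> by (simp add: abs_mult abs_prod del: prod.lessThan_Suc)
  then have rem: "\<bar>newton_rem (Suc q) f a x\<bar> = \<bar>?d (unit_nodes a (Suc q) @ [a + x]) * x\<bar> * ?P"
    unfolding newton_rem_eq_divided_diff abs_mult using \<open>x > 0\<close> by simp
  show ?thesis
  proof (cases "x \<in> real ` {1..q}")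
    case True
    then have P0: "?P = 0" by auto
    show ?thesis unfolding rem P0 by simp
  next
    case False
    then have x: "x \<noteq> real (Suc i)" if "i < q" for i
      using that by (metis False Suc_leI atLeastAtMost_iff imageI le_add1 plus_1_eq_Suc)
    define us where "us = unit_nodes (a + 1) q @ [a + x]"
    define vs where "vs = unit_nodes (a + real N + 1) (Suc q)"
    have us: "u \<in> {M<..} \<and> a < u \<and> u < a + real N + 1" if "u \<in> set us" for u
      using that assms by (auto simp: us_def set_unit_nodes)
    have vs: "v \<in> {M<..} \<and> a + real N + 1 \<le> v" if "v \<in> set vs" for v
      using that assms by (auto simp: vs_def set_unit_nodes)
    have "a + x \<notin> set (unit_nodes (a + 1) q)"
      using x by (auto simp: set_unit_nodes)
    then have dus: "distinct us" by (simp add: us_def distinct_unit_nodes)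
    have dvs: "distinct vs" by (simp add: vs_def distinct_unit_nodes)
    have len: "length us = q + 1" "length vs = q + 1" by (simp_all add: us_def vs_def)
    have cons: "unit_nodes a (Suc q) @ [a + x] = a # us"
      by (simp add: us_def unit_nodes_Cons)
    have "0 \<le> ?d (a # us)"
    proof -
      have "a \<notin> set us" using us by blast
      then have "distinct (a # us)" "set (a # us) \<subseteq> {M<..}" "length (a # us) = nat (int q + 2)"
        using dus us \<open>a > M\<close> len by (simp_all add: subset_iff)
      then show ?thesis using conv unfolding p_convex_on_def by blast
    qed
    then have lo: "0 \<le> ?d (a # us) * x" using \<open>x > 0\<close> by simp
    have "?d us \<le> ?d vs"
    proof (rule divided_diff_mono_nodes[OF conv])
      have sep: "u < v" if "u \<in> set us" "v \<in> set vs" for u v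
        using us[OF that(1)] vs[OF that(2)] by linarith
      show "list_all2 (<) us vs"
        unfolding list_all2_conv_all_nth using len by (auto intro: sep)
      have "set us \<inter> set vs = {}" by (auto dest: sep)
      then show "distinct (us @ vs)" using dus dvs by simp
      show "set us \<union> set vs \<subseteq> {M<..}" using us vs by blast
    qed (fact len)
    moreover have "?d (a # us) * x = ?d us - ?d (unit_nodes a (Suc q))"
      using \<open>x > 0\<close> by (simp add: us_def divided_diff_Cons_snoc unit_nodes_Cons)
    ultimately have hi: "?d (a # us) * x \<le>
        ((fwd_diff ^^ q) f (a + real N + 1) - (fwd_diff ^^ q) f a) / fact q"
      unfolding vs_def divided_diff_unit_nodes by (simp add: diff_divide_distrib)
    have "0 \<le> ?P" by (simp add: prod_nonneg)
    from mult_right_mono[OF hi this] lo show ?thesis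
      unfolding rem cons by (simp add: mult.commute)
  qed
qed

text \<open>
  The constant \<open>C\<close> may be negative, namely in the concave case. Keeping the difference on the right free of an
  absolute value is what makes the bound telescope.
\<close>

lemma newton_rem_bound:
  assumes "f \<in> K_class (int q)" "x > 0"
  shows "\<exists>C N. \<forall>\<^sub>F n in sequentially. \<bar>newton_rem (Suc q) f (real n) x\<bar> \<le>
    C * ((fwd_diff ^^ q) f (real (n + N)) - (fwd_diff ^^ q) f (real n))"
proof -
  from assms(1) obtain M where M: "p_convex_on (int q) {M<..} f \<or> p_concave_on (int q) {M<..} f"
    by (auto simp: K_class_def)
  define N where "N = max q (nat \<lceil>x\<rceil>)"
  have N: "x \<le> real N" "q \<le> N" by (auto simp: N_def) linarith
  define C where "C = (\<Prod>i=1..q. \<bar>x - real i\<bar>) / fact q"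
  let ?D = "fwd_diff ^^ q"
  have ev: "\<forall>\<^sub>F n in sequentially. real n > M"
    using filterlim_real_sequentially by (rule filterlim_at_top_dense[THEN iffD1, rule_format])
  have nN: "real n + real N + 1 = real (n + Suc N)" for n by simp
  from M show ?thesis
  proof
    assume conv: "p_convex_on (int q) {M<..} f"
    have "\<bar>newton_rem (Suc q) f (real n) x\<bar> \<le> C * (?D f (real (n + Suc N)) - ?D f (real n))"
      if "real n > M" for n
      using newton_rem_bound_convex[OF conv that assms(2) N] unfolding C_def nN .
    then show ?thesis using ev by (intro exI) (rule eventually_mono)
  next
    assume "p_concave_on (int q) {M<..} f"
    then have conv: "p_convex_on (int q) {M<..} (\<lambda>x. - f x)" by (simp add: p_concave_on_def)
    have "\<bar>newton_rem (Suc q) f (real n) x\<bar> \<le> (- C) * (?D f (real (n + Suc N)) - ?D f (real n))"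
      if "real n > M" for n
      using newton_rem_bound_convex[OF conv that assms(2) N]
      unfolding C_def[symmetric] nN newton_rem_minus fwd_diff_pow_minus
      by (simp add: right_diff_distrib)
    then show ?thesis using ev by (intro exI) (rule eventually_mono)
  qed
qed


section \<open>The sequence defining the principal sum\<close>

lemma D_class_fwd_diff_tendsto:
  assumes "g \<in> D_class p" "p \<le> j"
  shows "(\<lambda>n. (fwd_diff ^^ j) g (real n)) \<longlonglongrightarrow> 0"
  using assms(2)
proof (induction j rule: dec_induct)
  case base
  then show ?case using assms(1) by (simp add: D_class_def)
next
  case (step j)
  from tendsto_diff[OF LIMSEQ_Suc[OF step.IH] step.IH] show ?case
    by (simp add: fwd_diff_def add.commute)
qed

lemma D_class_mono: "p \<le> q \<Longrightarrow> D_class p \<subseteq> D_class q"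
  using D_class_fwd_diff_tendsto by (auto simp: D_class_def)

lemma f_seq_alt:
  "f_seq q h n x = (\<Sum>k=1..<n. h (real k)) - (\<Sum>k<n. h (x + real k))
     + (\<Sum>j<q. (x gchoose Suc j) * (fwd_diff ^^ j) h (real n))"
  by (simp add: f_seq_def sum.atLeast1_atMost_eq atLeast0LessThan del: gbinomial_Suc)

lemma f_seq_Suc_diff:
  assumes "n \<ge> 1"
  shows "f_seq q h (Suc n) x - f_seq q h n x = - newton_rem (Suc q) h (real n) x"
proof -
  have "(fwd_diff ^^ j) h (real (Suc n)) = (fwd_diff ^^ j) h (real n) + (fwd_diff ^^ Suc j) h (real n)"
    for j using fwd_diff_pow_plus1[of j h "real n"] by (simp add: add.commute)
  then show ?thesis
    using assms unfolding f_seq_alt newton_rem_def sum.lessThan_Suc_shift[of _ q]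
    by (simp add: algebra_simps sum.distrib del: funpow.simps)
qed

text \<open>So the limit in \<open>n\<close> solves \<open>\<Delta>f = h\<close> as soon as the remainder tends to \<open>0\<close>.\<close>

lemma f_seq_plus1_diff:
  "f_seq q h n (x + 1) - f_seq q h n x = h x - newton_rem q h (real n) x"
proof -
  have "(\<Sum>k<n. h (x + 1 + real k)) - (\<Sum>k<n. h (x + real k)) = h (x + real n) - h x"
    by (induction n) (simp_all add: algebra_simps)
  moreover have "(x + 1 gchoose Suc j) = (x gchoose j) + (x gchoose Suc j)" for j
    by (rule gbinomial_Suc_Suc)
  ultimately show ?thesis
    unfolding f_seq_alt newton_rem_def by (simp add: algebra_simps sum.distrib)
qed

text \<open>For a solution \<open>f\<close> of \<open>\<Delta>f = g\<close> the two sums of \<open>g\<close> telescope.\<close>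

lemma f_seq_solution:
  assumes sol: "\<And>x. x > 0 \<Longrightarrow> fwd_diff f x = g x" and "f 1 = 0" "x > 0" "n \<ge> 1"
  shows "f_seq q g n x = f x - newton_rem (Suc q) f (real n) x"
proof -
  have 1: "(\<Sum>k=1..<n. g (real k)) = f (real n)"
    using \<open>n \<ge> 1\<close>
  proof (induction n rule: dec_induct)
    case (step n)
    then show ?case using sol[of "real n"] by (simp add: fwd_diff_def add.commute)
  qed (simp add: \<open>f 1 = 0\<close>)
  have 2: "(\<Sum>k<n. g (x + real k)) = f (x + real n) - f x"
  proof (induction n)
    case (Suc n)
    have "g (x + real n) = f (x + real n + 1) - f (x + real n)"
      using sol[of "x + real n"] \<open>x > 0\<close> by (simp add: fwd_diff_def)
    with Suc show ?case by (simp add: algebra_simps)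
  qed simp
  have "(fwd_diff ^^ j) g (real n) = (fwd_diff ^^ Suc j) f (real n)" for j
    by (rule fwd_diff_pow_Suc_eq[symmetric]) (use sol \<open>n \<ge> 1\<close> in auto)
  then show ?thesis
    unfolding f_seq_alt newton_rem_def 1 2 sum.lessThan_Suc_shift
    by (simp add: algebra_simps del: funpow.simps)
qed

text \<open>
  Uniqueness of the principal sum: a solution in \<open>K\<^sup>q\<close> is determined by \<open>g\<close>. The remainder of \<open>f\<close>
  vanishes in the limit because its bound is a multiple of the sum of \<open>N\<close> consecutive values of
  \<open>\<Delta>\<^bsup>q+1\<^esup> f = \<Delta>\<^sup>q g\<close>.
\<close>

lemma f_seq_tendsto_solution:
  assumes f: "f \<in> K_class (int q)" and g: "g \<in> D_class q"
    and sol: "\<And>x. x > 0 \<Longrightarrow> fwd_diff f x = g x" and "f 1 = 0" "x > 0"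
  shows "(\<lambda>n. f_seq q g n x) \<longlonglongrightarrow> f x"
proof -
  let ?D = "fwd_diff ^^ q"
  obtain C N where bd: "\<forall>\<^sub>F n in sequentially. \<bar>newton_rem (Suc q) f (real n) x\<bar> \<le>
      C * (?D f (real (n + N)) - ?D f (real n))"
    using newton_rem_bound[OF f \<open>x > 0\<close>] by blast
  have Df: "(\<lambda>n. (fwd_diff ^^ Suc q) f (real n)) \<longlonglongrightarrow> 0"
  proof (rule Lim_transform_eventually)
    show "(\<lambda>n. ?D g (real n)) \<longlonglongrightarrow> 0" using g by (simp add: D_class_def)
    show "\<forall>\<^sub>F n in sequentially. ?D g (real n) = (fwd_diff ^^ Suc q) f (real n)"
      by (rule eventually_sequentiallyI[of 1]) (rule fwd_diff_pow_Suc_eq[symmetric], use sol in auto)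
  qed
  have "(\<lambda>n. ?D f (real (n + N)) - ?D f (real n)) \<longlonglongrightarrow> 0"
  proof (induction N)
    case (Suc N)
    have "(\<lambda>n. (?D f (real (n + N)) - ?D f (real n)) + (fwd_diff ^^ Suc q) f (real (n + N)))
        \<longlonglongrightarrow> 0 + 0"
      using Suc LIMSEQ_ignore_initial_segment[OF Df] by (rule tendsto_add)
    then show ?case by (simp add: fwd_diff_def[of "?D f"] add_ac)
  qed simp
  then have "(\<lambda>n. C * (?D f (real (n + N)) - ?D f (real n))) \<longlonglongrightarrow> 0"
    by (rule tendsto_mult_right_zero)
  then have "(\<lambda>n. newton_rem (Suc q) f (real n) x) \<longlonglongrightarrow> 0"
    by (rule tendsto_0_le[where K = 1]) (use bd in \<open>auto elim!: eventually_mono\<close>)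
  from tendsto_diff[OF tendsto_const[of "f x"] this]
  have "(\<lambda>n. f x - newton_rem (Suc q) f (real n) x) \<longlonglongrightarrow> f x" by simp
  then show ?thesis
    by (rule Lim_transform_eventually)
      (rule eventually_sequentiallyI[of 1], use f_seq_solution[of f g] sol assms(4,5) in simp)
qed

lemma f_seq_order_diff_tendsto_0:
  assumes "g \<in> D_class p" "p \<le> q"
  shows "(\<lambda>n. f_seq q g n x - f_seq p g n x) \<longlonglongrightarrow> 0"
  using assms(2)
proof (induction q rule: dec_induct)
  case (step q)
  have "(\<lambda>n. (f_seq q g n x - f_seq p g n x) + (x gchoose Suc q) * (fwd_diff ^^ q) g (real n))
      \<longlonglongrightarrow> 0 + (x gchoose Suc q) * 0"
    using step assms by (intro tendsto_intros D_class_fwd_diff_tendsto)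
  then show ?case by (simp add: f_seq_alt algebra_simps del: gbinomial_Suc)
qed simp

text \<open>The series is a sum of \<open>N\<close> telescoping ones.\<close>

lemma summable_shift_diff:
  fixes h :: "nat \<Rightarrow> real"
  assumes "h \<longlonglongrightarrow> 0"
  shows "summable (\<lambda>n. h (n + N) - h n)"
proof (induction N)
  case (Suc N)
  have "summable (\<lambda>n. (h (n + N) - h n) + (h (Suc n + N) - h (n + N)))"
    using Suc telescope_summable[OF LIMSEQ_ignore_initial_segment[OF assms, of N]]
    by (rule summable_add)
  then show ?case by simp
qed simp

lemma newton_rem_summable:
  assumes "g \<in> D_class q \<inter> K_class (int q)" "x > 0"
  shows "summable (\<lambda>n. newton_rem (Suc q) g (real n) x)"
proof -
  let ?h = "\<lambda>n. (fwd_diff ^^ q) g (real n)"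
  obtain C N where bd: "\<forall>\<^sub>F n in sequentially. \<bar>newton_rem (Suc q) g (real n) x\<bar> \<le>
      C * (?h (n + N) - ?h n)"
    using newton_rem_bound[of g q x] assms by blast
  have "summable (\<lambda>n. C * (?h (n + N) - ?h n))"
    using assms by (intro summable_mult summable_shift_diff) (simp add: D_class_def)
  then show ?thesis by (rule summable_comparison_test_ev[rotated]) (use bd in simp)
qed

text \<open>
  On \<open>q + 2\<close> points the constant and the polynomial part of \<open>f\<^sub>n\<^sup>q[g]\<close> contribute nothing.
\<close>

lemma divided_diff_f_seq:
  assumes "distinct xs" "length xs = q + 2"
  shows "divided_diff (f_seq q g n) xs =
    - (\<Sum>k<n. divided_diff g (map (\<lambda>x. x + real k) xs))"
proof -
  let ?c = "\<Sum>k=1..<n. g (real k)" and ?D = "\<lambda>j. (fwd_diff ^^ j) g (real n)"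
  have eq: "f_seq q g n = (\<lambda>x. (?c + - (\<Sum>k<n. g (x + real k))) + (\<Sum>j<q. ?D j * (x gchoose Suc j)))"
    by (rule ext) (simp add: f_seq_alt mult.commute del: gbinomial_Suc)
  have "divided_diff (\<lambda>x. x gchoose Suc j) xs = 0" if "j < q" for j
    using assms that by (intro divided_diff_gchoose) auto
  then show ?thesis
    unfolding eq divided_diff_add divided_diff_minus divided_diff_sum divided_diff_cmult
      divided_diff_shift
    using assms by (simp add: divided_diff_const)
qed

text \<open>
  Existence of the principal sum, as the pointwise limit of the sequence \<open>f\<^sub>n\<^sup>q[g]\<close>. It converges because its
  increments are summable, and divided differences pass to the limit; their sign is opposite to that
  of \<open>g\<close>, so eventual \<open>q\<close>-convexity of \<open>g\<close> makes the solution eventually \<open>q\<close>-concave.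
\<close>

lemma principal_solution_exists:
  assumes g: "g \<in> D_class q \<inter> K_class (int q)"
  obtains f where "f \<in> extensional {0<..}" "f \<in> K_class (int q)"
    "\<And>x. x > 0 \<Longrightarrow> fwd_diff f x = g x" "f 1 = 0"
proof
  let ?F = "\<lambda>n. f_seq q g n"
  define f where "f = restrict (\<lambda>x. lim (\<lambda>n. ?F n x)) {0<..}"
  show "f \<in> extensional {0<..}" by (simp add: f_def)
  have lim: "(\<lambda>n. ?F n x) \<longlonglongrightarrow> f x" if "x > 0" for x
  proof -
    have "summable (\<lambda>n. - newton_rem (Suc q) g (real (Suc n)) x)"
      using newton_rem_summable[OF g that] by (intro summable_minus) (rule summable_Suc_iff[THEN iffD2])
    then have "summable (\<lambda>n. ?F (Suc (Suc n)) x - ?F (Suc n) x)"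
      by (simp add: f_seq_Suc_diff del: of_nat_Suc)
    then have "convergent (\<lambda>n. \<Sum>k<n. ?F (Suc (Suc k)) x - ?F (Suc k) x)"
      by (simp add: summable_iff_convergent)
    then have "convergent (\<lambda>n. ?F (Suc n) x - ?F (Suc 0) x)"
      unfolding sum_lessThan_telescope[of "\<lambda>k. ?F (Suc k) x"] .
    then have "convergent (\<lambda>n. ?F (Suc n) x - ?F (Suc 0) x + ?F (Suc 0) x)"
      by (intro convergent_add convergent_const)
    then have "convergent (\<lambda>n. ?F n x)" by (simp add: convergent_Suc_iff[of "\<lambda>n. ?F n x"])
    then show ?thesis using that by (simp add: f_def convergent_LIMSEQ_iff)
  qed
  have D: "(\<lambda>n. (fwd_diff ^^ q) g (real n)) \<longlonglongrightarrow> 0" using g by (simp add: D_class_def)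
  show "fwd_diff f x = g x" if "x > 0" for x
  proof -
    have "(\<lambda>n. newton_rem (Suc q) g (real n) x + (x gchoose q) * (fwd_diff ^^ q) g (real n))
        \<longlonglongrightarrow> 0 + (x gchoose q) * 0"
      using summable_LIMSEQ_zero[OF newton_rem_summable[OF g that]] D
      by (intro tendsto_intros)
    then have "(\<lambda>n. newton_rem q g (real n) x) \<longlonglongrightarrow> 0" by (simp add: newton_rem_def)
    then have "(\<lambda>n. g x - newton_rem q g (real n) x) \<longlonglongrightarrow> g x - 0"
      by (intro tendsto_intros)
    then have "(\<lambda>n. ?F n (x + 1) - ?F n x) \<longlonglongrightarrow> g x" by (simp add: f_seq_plus1_diff)
    moreover have "(\<lambda>n. ?F n (x + 1) - ?F n x) \<longlonglongrightarrow> f (x + 1) - f x"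
      using that by (intro tendsto_diff lim) auto
    ultimately show ?thesis unfolding fwd_diff_def using LIMSEQ_unique by blast
  qed
  show "f 1 = 0"
  proof -
    \<comment> \<open>For \<open>q > 0\<close> the term with \<open>j = 1\<close> cancels \<open>- g n\<close>; for \<open>q = 0\<close> it is absent, but \<open>g n\<close> tends to \<open>0\<close>.\<close>
    have "\<forall>\<^sub>F n in sequentially. ?F n 1 = (if q = 0 then - (fwd_diff ^^ q) g (real n) else 0)"
    proof (rule eventually_sequentiallyI[of 1])
      fix n :: nat assume n: "1 \<le> n"
      have "(\<Sum>k<n. g (1 + real k)) = (\<Sum>k=1..<Suc n. g (real k))"
        by (simp add: sum.shift_bounds_Suc_ivl atLeast0LessThan del: sum.op_ivl_Suc)
      then have sums: "(\<Sum>k=1..<n. g (real k)) - (\<Sum>k<n. g (1 + real k)) = - g (real n)"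
        using n by simp
      have "(1::real) gchoose Suc (Suc j) = 0" for j
        using gbinomial_Suc_Suc[of "0::real" "Suc j"] by simp
      then have "(\<Sum>j<q. ((1::real) gchoose Suc j) * (fwd_diff ^^ j) g (real n)) =
          (if q = 0 then 0 else g (real n))"
        by (cases q) (simp_all add: sum.lessThan_Suc_shift del: gbinomial_Suc sum.lessThan_Suc)
      then show "?F n 1 = (if q = 0 then - (fwd_diff ^^ q) g (real n) else 0)"
        unfolding f_seq_alt sums by simp
    qed
    moreover have "(\<lambda>n. if q = 0 then - (fwd_diff ^^ q) g (real n) else 0) \<longlonglongrightarrow> 0"
      using tendsto_minus[OF D] by (cases "q = 0") simp_all
    ultimately have "(\<lambda>n. ?F n 1) \<longlonglongrightarrow> 0" by (simp add: tendsto_cong)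
    then show ?thesis using lim[of 1] LIMSEQ_unique by fastforce
  qed
  from g obtain M where "M \<ge> 0"
    and M: "p_convex_on (int q) {M<..} g \<or> p_concave_on (int q) {M<..} g"
    by (auto simp: K_class_def)
  have dd: "(\<lambda>n. - (\<Sum>k<n. divided_diff g (map (\<lambda>x. x + real k) xs))) \<longlonglongrightarrow> divided_diff f xs"
    if "distinct xs" "length xs = nat (int q + 2)" "set xs \<subseteq> {M<..}" for xs
  proof -
    have "(\<lambda>n. divided_diff (?F n) xs) \<longlonglongrightarrow> divided_diff f xs"
      using that \<open>M \<ge> 0\<close> by (intro tendsto_divided_diff lim) auto
    then show ?thesis using that by (simp add: divided_diff_f_seq)
  qed
  have shift: "distinct (map (\<lambda>x. x + real k) xs) \<and> set (map (\<lambda>x. x + real k) xs) \<subseteq> {M<..}"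
    if "distinct xs" "set xs \<subseteq> {M<..}" for xs k
    using that by (auto simp: distinct_map inj_on_def)
  from M have "p_concave_on (int q) {M<..} f \<or> p_convex_on (int q) {M<..} f"
  proof
    assume conv: "p_convex_on (int q) {M<..} g"
    have "divided_diff f xs \<le> 0"
      if xs: "length xs = nat (int q + 2)" "distinct xs" "set xs \<subseteq> {M<..}" for xs
    proof (rule LIMSEQ_le_const2[OF dd], goal_cases)
      case 4
      have "0 \<le> divided_diff g (map (\<lambda>x. x + real k) xs)" for k
        using conv xs shift[of xs k] unfolding p_convex_on_def by simp
      then show ?case by (simp add: sum_nonneg)
    qed (use xs in auto)
    then show ?thesis by (simp add: p_concave_on_def p_convex_on_def divided_diff_minus)
  next
    assume conc: "p_concave_on (int q) {M<..} g"
    have "divided_diff f xs \<ge> 0"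
      if xs: "length xs = nat (int q + 2)" "distinct xs" "set xs \<subseteq> {M<..}" for xs
    proof (rule LIMSEQ_le_const[OF dd], goal_cases)
      case 4
      have "divided_diff g (map (\<lambda>x. x + real k) xs) \<le> 0" for k
        using conc xs shift[of xs k]
        unfolding p_concave_on_def p_convex_on_def divided_diff_minus by simp
      then show ?case by (simp add: sum_nonpos)
    qed (use xs in auto)
    then show ?thesis by (simp add: p_convex_on_def)
  qed
  then show "f \<in> K_class (int q)" using \<open>M \<ge> 0\<close> by (auto simp: K_class_def)
qed


section \<open>The principal sum and its iterates\<close>

lemma principal_sum_properties:
  assumes g: "g \<in> D_class q \<inter> K_class (int q)"
  shows "principal_sum g \<in> K_class (int q)"
    and "x > 0 \<Longrightarrow> fwd_diff (principal_sum g) x = g x"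
    and "x > 0 \<Longrightarrow> (\<lambda>n. f_seq q g n x) \<longlonglongrightarrow> principal_sum g x"
proof -
  let ?Q = "\<lambda>f p. g \<in> D_class p \<inter> K_class (int p) \<and> f \<in> K_class (int p)"
  let ?P = "\<lambda>f. f \<in> extensional {0<..} \<and> (\<exists>p::nat. ?Q f p) \<and> (\<forall>x>0. fwd_diff f x = g x) \<and> f 1 = 0"
  obtain f where f: "f \<in> extensional {0<..}" "f \<in> K_class (int q)"
    "\<And>x. x > 0 \<Longrightarrow> fwd_diff f x = g x" "f 1 = 0"
    using principal_solution_exists[OF g] by blast
  have lim: "(\<lambda>n. f_seq p g n x) \<longlonglongrightarrow> f' x"
    if "?Q f' p" "\<forall>x>0. fwd_diff f' x = g x" "f' 1 = 0" "x > 0" for f' p x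
    using that by (intro f_seq_tendsto_solution) auto
  \<comment> \<open>The orders of the two candidates may differ.\<close>
  have eq: "f' = f" if f': "?P f'" for f'
  proof (rule extensionalityI)
    fix x :: real assume "x \<in> {0<..}"
    then have "x > 0" by simp
    from f' obtain p where p: "?Q f' p" by blast
    have lp: "(\<lambda>n. f_seq p g n x) \<longlonglongrightarrow> f' x" using p f' \<open>x > 0\<close> by (intro lim) auto
    have lq: "(\<lambda>n. f_seq q g n x) \<longlonglongrightarrow> f x" using f g \<open>x > 0\<close> by (intro lim) auto
    have "(\<lambda>n. f_seq q g n x - f_seq p g n x) \<longlonglongrightarrow> 0"
    proof (cases "p \<le> q")
      case True
      then show ?thesis using p by (intro f_seq_order_diff_tendsto_0) auto
    next
      case False
      then have "(\<lambda>n. f_seq p g n x - f_seq q g n x) \<longlonglongrightarrow> 0"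
        using g by (intro f_seq_order_diff_tendsto_0) auto
      from tendsto_minus[OF this] show ?thesis by simp
    qed
    with tendsto_diff[OF lq lp] have "f x - f' x = 0" by (rule LIMSEQ_unique)
    then show "f' x = f x" by simp
  qed (use f f' in auto)
  have "?P f" using f g by auto
  then have ps: "principal_sum g = f" unfolding principal_sum_def using eq by (rule the_equality)
  show "principal_sum g \<in> K_class (int q)" using f ps by simp
  show "fwd_diff (principal_sum g) x = g x" if "x > 0" using f ps that by simp
  show "(\<lambda>n. f_seq q g n x) \<longlonglongrightarrow> principal_sum g x" if "x > 0"
    unfolding ps using f g that by (intro lim) auto
qed

lemma D_class_Suc_of_fwd_diff:
  assumes "g \<in> D_class p" "\<And>x. x > 0 \<Longrightarrow> fwd_diff f x = g x"
  shows "f \<in> D_class (Suc p)"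
proof -
  have "(\<lambda>n. (fwd_diff ^^ p) g (real n)) \<longlonglongrightarrow> 0" using assms by (simp add: D_class_def)
  moreover have "\<forall>\<^sub>F n in sequentially. (fwd_diff ^^ p) g (real n) = (fwd_diff ^^ Suc p) f (real n)"
    by (rule eventually_sequentiallyI[of 1])
      (rule fwd_diff_pow_Suc_eq[symmetric], use assms in auto)
  ultimately show ?thesis
    unfolding D_class_def mem_Collect_eq by (rule Lim_transform_eventually)
qed

text \<open>
  As long as \<open>k \<le> m\<close>, the growing index of \<open>D\<close> does not exceed the fixed index of \<open>K\<close>, so each iterate is
  in the intersection of both classes of order \<open>p + m\<close>.
\<close>

lemma principal_sum_iterate_class:
  assumes "g \<in> D_class p \<inter> K_class (int (p + m))" "k \<le> m"
  shows "(principal_sum ^^ k) g \<in> D_class (p + k) \<inter> K_class (int (p + m))"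
  using assms(2)
proof (induction k)
  case 0
  then show ?case using assms(1) by simp
next
  case (Suc k)
  let ?G = "(principal_sum ^^ k) g"
  have G: "?G \<in> D_class (p + k) \<inter> K_class (int (p + m))" using Suc by simp
  moreover have "D_class (p + k) \<subseteq> D_class (p + m)" using Suc.prems by (intro D_class_mono) simp
  ultimately have G': "?G \<in> D_class (p + m) \<inter> K_class (int (p + m))" by blast
  show ?case
    using principal_sum_properties(1)[OF G'] G
      D_class_Suc_of_fwd_diff[OF _ principal_sum_properties(2)[OF G']] by simp
qed

theorem corollary3p3:
  fixes x :: real and m p :: nat and g :: "real \<Rightarrow> real"
  assumes "x > 0"
    and "g \<in> D_class p \<inter> K_class (int (p + m))"
  shows "(\<lambda>n::nat. f_seq (p + m) ((principal_sum ^^ m) g) n x)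
           \<longlonglongrightarrow> (principal_sum ^^ (m + 1)) g x"
  using principal_sum_properties(3)[OF principal_sum_iterate_class[OF assms(2) order_refl] assms(1)]
  by simp

end
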